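(* There are no positive integers $x, y$ with $y > x$ satisfying $$(y-x)^{x+y} = y^x.$$ *)

theory Defs
  imports Complex_Main
begin

end

(* With d = y - x the equation reads d^d * (d^2)^x = y^x, so d^2 divides y, say y = d^2 k.
   Then d^d = k^x with x = d (d k - 1), hence d = k^(d k - 1), which is too large once k > 1. *)
theory Submission
  imports Defs
begin

text \<open>With \<open>d = y - x\<close>, comparing \<open>x\<close>-th powers forces
  \<open>y = d\<^sup>2 * k\<close>, and cancelling leaves \<open>d ^ d = k ^ x\<close>. Since
  \<open>d\<close> divides \<open>x = y - d\<close>, a \<open>d\<close>-th root can be taken:
  \<open>d = k ^ (d * k - 1)\<close>. Exponential growth excludes this for
  \<open>k \<ge> 2\<close>.\<close>

theorem mainTheorem11:
  shows "\<not> (\<exists>x y :: nat. x > 0 \<and> y > 0 \<and> y > x \<and> (y - x) ^ (x + y) = y ^ x)"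
proof
  assume "\<exists>x y :: nat. x > 0 \<and> y > 0 \<and> y > x \<and> (y - x) ^ (x + y) = y ^ x"
  then obtain x y :: nat where x: "x > 0" and xy: "y > x" and eq: "(y - x) ^ (x + y) = y ^ x"
    by blast
  define d where "d = y - x"
  have d: "d > 0" and y: "y = x + d"
    using xy by (auto simp: d_def)
  have "x + y = d + 2 * x"
    using y by simp
  with eq have "d ^ (d + 2 * x) = y ^ x"
    by (metis d_def)
  then have eq': "d ^ d * (d\<^sup>2) ^ x = y ^ x"
    by (simp add: power_add power_mult)
  then have "(d\<^sup>2) ^ x dvd y ^ x"
    by (metis dvd_triv_right)
  \<comment> \<open>For a positive exponent, divisibility of powers passes to the bases.\<close>
  then have "d\<^sup>2 dvd y"
    using x by simp
  then obtain k where k: "y = d\<^sup>2 * k"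
    by blast
  have dk: "d ^ d = k ^ x"
    using eq' d by (simp add: k power_mult_distrib)
  have x_eq: "x = (d * k - 1) * d"
    using y k by (simp add: power2_eq_square algebra_simps)
  have "d ^ d = (k ^ (d * k - 1)) ^ d"
    using dk unfolding power_mult[symmetric] x_eq[symmetric] .
  then have d_eq: "d = k ^ (d * k - 1)"
    using d by (metis power_eq_imp_eq_base zero_le)
  consider "k = 0" | "k = 1" | "k \<ge> 2"
    by linarith
  then show False
  proof cases
    case 1
    then show False using k xy by simp
  next
    \<comment> \<open>Here \<open>d = 1\<close>, so \<open>x = (1 * 1 - 1) * 1 = 0\<close>, against
      \<open>x > 0\<close>.\<close>
    case 2
    then show False using d_eq x_eq x by simp
  next
    case 3
    then have "d * 2 \<le> d * k"
      by simp
    \<comment> \<open>From \<open>2 * d \<le> d * k\<close> and \<open>d \<ge> 1\<close>.\<close>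
    then have "d \<le> d * k - 1"
      using d by linarith
    also have "\<dots> < 2 ^ (d * k - 1)"
      by (rule less_exp)
    also have "\<dots> \<le> k ^ (d * k - 1)"
      using 3 by (simp add: power_mono)
    finally show False
      using d_eq by simp
  qed
qed

end
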